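(* Quasi all $f \in C(\mathbb{T})$ have the property that $(s_n f)_n$ is uniformly universal on $E$ for quasi all sets $E \in \mathcal{K}(\mathbb{T})$.
   Context: $\mathbb{T} = \mathbb{R}/2\pi\mathbb{Z}$ is the unit circle. For compact $E \subset \mathbb{T}$, $C(E)$ is the space of continuous functions $E \to \mathbb{C}$ with the norm $\|f\|_E = \max_{t \in E} |f(t)|$; in particular $C(\mathbb{T})$ carries the norm $\|\cdot\| = \|\cdot\|_{\mathbb{T}}$. For $f \in C(\mathbb{T})$ and $n \in \mathbb{N}$, $s_n f$ denotes the $n$-th partial sum of the Fourier series of $f$, i.e. $(s_n f)(t) = \sum_{k=-n}^{n} \hat f(k) e^{ikt}$ with $\hat f(k) = \frac{1}{2\pi}\int_{\mathbb{T}} f(s) e^{-iks}\,ds$. For a compact set $E \subset \mathbb{T}$, $(s_n f)_n$ is called uniformly universal on $E$ if $\{ (s_n f)|_E : n \in \mathbb{N}\}$ is dense in $(C(E), \|\cdot\|_E)$. $\mathcal{K}(\mathbb{T})$ is the complete metric space of all nonempty compact subsets of $\mathbb{T}$ with the Hausdorff metric. In a complete metric space $X$, a property is said to hold for quasi all $x \in X$ if it holds on a residual subset of $X$, that is, on a set containing a dense $G_\delta$ subset of $X$. *)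

theory Defs
  imports "HOL-Analysis.Analysis"
begin

section \<open>Residual sets\<close>

definition residual_in :: "'a topology \<Rightarrow> 'a set \<Rightarrow> bool" where
  "residual_in X S \<longleftrightarrow>
     S \<subseteq> topspace X \<and> (\<exists>G. gdelta_in X G \<and> X closure_of G = topspace X \<and> G \<subseteq> S)"

definition quasi_all :: "'a metric \<Rightarrow> ('a \<Rightarrow> bool) \<Rightarrow> bool" where
  "quasi_all m P \<longleftrightarrow> residual_in (mtopology_of m) {x \<in> mspace m. P x}"


section \<open>Nonempty compact sets with the Hausdorff metric\<close>

definition compacts :: "'a::metric_space set \<Rightarrow> 'a set set" where
  "compacts S = {A. compact A \<and> A \<noteq> {} \<and> A \<subseteq> S}"

text \<open>
  The suprema are meaningful for nonempty bounded sets only. The value 0 elsewhere is needed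
  because the locale \<^locale>\<open>Metric_space\<close> asks for nonnegativity outside the carrier, too.
\<close>

definition hausdorff_dist :: "'a::metric_space set \<Rightarrow> 'a set \<Rightarrow> real" where
  "hausdorff_dist A B =
     (if A \<in> compacts UNIV \<and> B \<in> compacts UNIV
      then max (SUP x\<in>A. infdist x B) (SUP y\<in>B. infdist y A) else 0)"

definition hausdorff_metric :: "'a::metric_space set \<Rightarrow> 'a set metric" where
  "hausdorff_metric S = metric (compacts S, hausdorff_dist)"

lemma compacts_UNIV: "A \<in> compacts S \<Longrightarrow> A \<in> compacts UNIV"
  by (simp add: compacts_def)

lemma bdd_above_infdist:
  fixes A B :: "'a::metric_space set"
  assumes "compact A"
  shows "bdd_above ((\<lambda>x. infdist x B) ` A)"
  by (intro bounded_imp_bdd_above compact_imp_bounded compact_continuous_image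
      continuous_intros assms)

lemma hausdorff_dist_le_iff:
  assumes "A \<in> compacts UNIV" "B \<in> compacts UNIV"
  shows "hausdorff_dist A B \<le> r \<longleftrightarrow> (\<forall>x\<in>A. infdist x B \<le> r) \<and> (\<forall>y\<in>B. infdist y A \<le> r)"
proof -
  have "compact A" "A \<noteq> {}" "compact B" "B \<noteq> {}"
    using assms by (auto simp: compacts_def)
  then show ?thesis
    using assms by (simp add: hausdorff_dist_def cSUP_le_iff bdd_above_infdist)
qed

lemma hausdorff_dist_nonneg: "0 \<le> hausdorff_dist A B"
proof (cases "A \<in> compacts UNIV \<and> B \<in> compacts UNIV")
  case True
  then obtain a where "a \<in> A"
    by (auto simp: compacts_def)
  with True have "infdist a B \<le> hausdorff_dist A B"
    using hausdorff_dist_le_iff by blast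
  then show ?thesis
    using infdist_nonneg order_trans by blast
qed (auto simp: hausdorff_dist_def)

lemma infdist_le_infdist_add:
  assumes "B \<noteq> {}" and "\<And>y. y \<in> B \<Longrightarrow> infdist y C \<le> s"
  shows "infdist x C \<le> infdist x B + s"
proof -
  have "infdist x C - s \<le> dist x y" if "y \<in> B" for y
    using infdist_triangle [of x C y] assms(2) [OF that] by linarith
  then have "infdist x C - s \<le> infdist x B"
    unfolding infdist_notempty [OF assms(1)] by (intro cINF_greatest assms(1))
  then show ?thesis
    by linarith
qed

lemma Metric_space_hausdorff: "Metric_space (compacts S) hausdorff_dist"
proof
  fix A B :: "'a set"
  show "0 \<le> hausdorff_dist A B"
    by (rule hausdorff_dist_nonneg)
  show "hausdorff_dist A B = hausdorff_dist B A"
    by (auto simp: hausdorff_dist_def max.commute)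
next
  fix A B :: "'a set"
  assume "A \<in> compacts S" "B \<in> compacts S"
  then have *: "A \<in> compacts UNIV" "B \<in> compacts UNIV"
    and c: "closed A" "A \<noteq> {}" "closed B" "B \<noteq> {}"
    by (auto simp: compacts_def compact_imp_closed)
  have "hausdorff_dist A B = 0 \<longleftrightarrow> hausdorff_dist A B \<le> 0"
    using hausdorff_dist_nonneg [of A B] by linarith
  also have "\<dots> \<longleftrightarrow> (\<forall>x\<in>A. infdist x B = 0) \<and> (\<forall>y\<in>B. infdist y A = 0)"
    unfolding hausdorff_dist_le_iff [OF *] by (simp add: order.eq_iff infdist_nonneg)
  also have "\<dots> \<longleftrightarrow> A = B"
    using in_closed_iff_infdist_zero [OF c(1,2)] in_closed_iff_infdist_zero [OF c(3,4)] by blast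
  finally show "hausdorff_dist A B = 0 \<longleftrightarrow> A = B" .
next
  fix A B C :: "'a set"
  assume "A \<in> compacts S" "B \<in> compacts S" "C \<in> compacts S"
  then have *: "A \<in> compacts UNIV" "B \<in> compacts UNIV" "C \<in> compacts UNIV" and ne: "B \<noteq> {}"
    by (auto simp: compacts_def)
  have AB: "infdist x B \<le> hausdorff_dist A B" if "x \<in> A" for x
    using hausdorff_dist_le_iff [OF *(1,2)] that by blast
  have BA: "infdist y A \<le> hausdorff_dist A B" if "y \<in> B" for y
    using hausdorff_dist_le_iff [OF *(1,2)] that by blast
  have BC: "infdist y C \<le> hausdorff_dist B C" if "y \<in> B" for y
    using hausdorff_dist_le_iff [OF *(2,3)] that by blast
  have CB: "infdist z B \<le> hausdorff_dist B C" if "z \<in> C" for z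
    using hausdorff_dist_le_iff [OF *(2,3)] that by blast
  have "infdist x C \<le> hausdorff_dist A B + hausdorff_dist B C" if "x \<in> A" for x
    using infdist_le_infdist_add [OF ne BC, of x] AB [OF that] by linarith
  moreover have "infdist z A \<le> hausdorff_dist A B + hausdorff_dist B C" if "z \<in> C" for z
    using infdist_le_infdist_add [OF ne BA, of z] CB [OF that] by linarith
  ultimately show "hausdorff_dist A C \<le> hausdorff_dist A B + hausdorff_dist B C"
    unfolding hausdorff_dist_le_iff [OF *(1,3)] by blast
qed

lemma mspace_hausdorff_metric [simp]: "mspace (hausdorff_metric S) = compacts S"
  by (simp add: hausdorff_metric_def Metric_space.mspace_metric [OF Metric_space_hausdorff])

lemma mdist_hausdorff_metric [simp]: "mdist (hausdorff_metric S) = hausdorff_dist"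
  by (simp add: hausdorff_metric_def Metric_space.mdist_metric [OF Metric_space_hausdorff])


section \<open>Continuous functions and Fourier sums on the circle\<close>

text \<open>
  The circle R/2piZ is realised as the unit circle in the complex plane, the class of \<open>t\<close>
  being the point \<open>cis t\<close>.
\<close>

abbreviation circle :: "complex set" where
  "circle \<equiv> sphere 0 1"

text \<open>
  The library's space of bounded continuous functions with the supremum distance; its elements
  take the value \<^const>\<open>undefined\<close> outside of \<open>E\<close>.
\<close>

definition C_metric :: "complex set \<Rightarrow> (complex \<Rightarrow> complex) metric" where
  "C_metric E = cfunspace (top_of_set E) euclidean_metric"

lemma mspace_C_metric:
  assumes "compact E"
  shows "mspace (C_metric E) = {f \<in> extensional E. continuous_on E f}"
  using compact_imp_bounded [OF compact_continuous_image [OF _ assms]]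
  by (auto simp: C_metric_def)

lemma mdist_C_metric:
  assumes "E \<noteq> {}" "f \<in> mspace (C_metric E)" "g \<in> mspace (C_metric E)"
  shows "mdist (C_metric E) f g = (SUP z\<in>E. cmod (f z - g z))"
  using assms
  by (simp add: C_metric_def mdist_cfunspace_eq_mdist_funspace
      Met_TC.fdist_def Met_TC.fspace_def dist_norm)

definition fourier_coeff :: "(complex \<Rightarrow> complex) \<Rightarrow> int \<Rightarrow> complex" where
  "fourier_coeff f k =
     complex_of_real (1 / (2 * pi)) * integral {0..2 * pi} (\<lambda>s. f (cis s) * cis (- (of_int k * s)))"

definition fourier_sum :: "nat \<Rightarrow> (complex \<Rightarrow> complex) \<Rightarrow> complex \<Rightarrow> complex" where
  "fourier_sum n f z = (\<Sum>k = - int n..int n. fourier_coeff f k * z powi k)"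

lemma fourier_sum_cis:
  "fourier_sum n f (cis t) =
     (\<Sum>k = - int n..int n. fourier_coeff f k * exp (\<i> * of_int k * of_real t))"
  unfolding fourier_sum_def cis_power_int by (simp add: cis_conv_exp mult.assoc)

lemma restrict_fourier_sum_in_C:
  assumes "compact E" "E \<subseteq> circle"
  shows "restrict (fourier_sum n f) E \<in> mspace (C_metric E)"
proof -
  have "continuous_on E (fourier_sum n f)"
    unfolding fourier_sum_def using assms by (auto intro!: continuous_intros)
  then show ?thesis
    using assms by (simp add: mspace_C_metric cong: continuous_on_cong)
qed

definition uniformly_universal_on :: "complex set \<Rightarrow> (nat \<Rightarrow> complex \<Rightarrow> complex) \<Rightarrow> bool" where
  "uniformly_universal_on E s \<longleftrightarrow>
     mtopology_of (C_metric E) closure_of range (\<lambda>n. restrict (s n) E) = mspace (C_metric E)"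

end

theory Submission
  imports Defs
begin

text \<open>
  The proof reduces generic compact sets to finite ones. Fix a countable family of continuous targets
  \<open>g\<close> whose restrictions are dense in \<open>C(E)\<close> for every compact \<open>E\<close>, and a countable dense subset \<open>D\<close> of the
  circle. Suppose that for all finite \<open>F \<subseteq> D\<close>, all targets \<open>g\<close> and all \<open>m\<close>, some Fourier sum of \<open>f\<close> is
  closer than \<open>1 / (m + 1)\<close> to \<open>g\<close> on \<open>F\<close>. For fixed \<open>g\<close> and \<open>m\<close>, the compact sets on which some Fourier sum
  of \<open>f\<close> is that close to \<open>g\<close> are an open set in the Hausdorff metric, and it contains all nonempty finite subsets of
  \<open>D\<close>, which are dense. The intersection over \<open>g\<close> and \<open>m\<close> is hence a dense G-delta set, and it consists of
  sets of uniform universality for \<open>f\<close>; this is \<open>quasi_all_universal_if_close_on_finite\<close>.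

  The supposition amounts to countably many conditions on \<open>f\<close>. By the Baire category theorem in \<open>C(T)\<close> it
  remains to show that each of them is open (\<open>openin_fourier_sum_close\<close>) and dense
  (\<open>dense_fourier_sum_close\<close>). For density, approximate a function by a trigonometric polynomial, which
  equals its Fourier sums of large order, and add a small function whose Fourier sum of some large order
  has the prescribed differences as its values on \<open>F\<close>, up to a small error
  (\<open>small_function_with_prescribed_fourier_sum\<close>).

  That function is a combination of rotated polynomials of Fejer. With
  \<open>P\<^sub>n(z) = (\<Sum>k=1..n. (z ^ (n - k) - z ^ (n + k)) / k)\<close>, the modulus of \<open>P\<^sub>n\<close> is that of twice a sine sum and
  so at most 6 on the circle. Its \<open>n\<close>-th Fourier sum \<open>(\<Sum>k=1..n. z ^ (n - k) / k)\<close> is the harmonic number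
  \<open>H\<^sub>n\<close> at \<open>z = 1\<close>, whereas it remains bounded as \<open>n\<close> grows at each other point. Therefore \<open>P\<^sub>n / H\<^sub>n\<close> tends
  to 0 uniformly, while its \<open>n\<close>-th Fourier sum tends to the indicator of 1. All points of \<open>F\<close> can be treated
  with the same \<open>n\<close>, so the Fourier sums of the combination converge to any prescribed values on \<open>F\<close>.
\<close>

section \<open>Fourier sums of continuous functions\<close>

lemma has_integral_cis_multiple:
  assumes "m \<noteq> 0"
  shows "((\<lambda>s. cis (of_int m * s)) has_integral 0) {0..2 * pi}"
proof -
  have "((\<lambda>s. cis (of_int m * s) / (\<i> * of_int m)) has_vector_derivative cis (of_int m * s))
      (at s within {0..2 * pi})" for s :: real
    using assms unfolding cis_conv_exp
    by (auto intro!: derivative_eq_intros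
        has_vector_derivative_real_field simp: field_simps)
  then have "((\<lambda>s. cis (of_int m * s)) has_integral
      cis (of_int m * (2 * pi)) / (\<i> * of_int m) - cis (of_int m * 0) / (\<i> * of_int m)) {0..2 * pi}"
    by (intro fundamental_theorem_of_calculus) auto
  moreover have "cis (of_int m * (2 * pi)) = 1"
    using cis_multiple_2pi [of "of_int m"] by (simp add: mult_ac)
  ultimately show ?thesis
    by simp
qed

lemma fourier_coeff_powi: "fourier_coeff (\<lambda>z. z powi j) k = (if k = j then 1 else 0)"
proof -
  have eq: "cis s powi j * cis (- (of_int k * s)) = cis (of_int (j - k) * s)" for s
    by (simp add: cis_power_int cis_mult algebra_simps)
  show ?thesis
  proof (cases "k = j")
    case True
    then show ?thesis
      unfolding fourier_coeff_def eq by (simp add: scaleR_conv_of_real)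
  next
    case False
    then have "integral {0..2 * pi} (\<lambda>s. cis (of_int (j - k) * s)) = 0"
      by (intro integral_unique has_integral_cis_multiple) auto
    with False show ?thesis
      unfolding fourier_coeff_def eq by simp
  qed
qed

lemma fourier_integrand_continuous:
  assumes "continuous_on circle f"
  shows "continuous_on T (\<lambda>s. f (cis s) * cis (- (of_int k * s)))"
proof -
  have "continuous_on T (\<lambda>s. f (cis s))"
    by (rule continuous_on_compose2 [OF assms]) (auto intro!: continuous_intros)
  then show ?thesis
    by (intro continuous_intros)
qed

lemma fourier_coeff_add:
  assumes "continuous_on circle f" "continuous_on circle g"
  shows "fourier_coeff (\<lambda>z. f z + g z) k = fourier_coeff f k + fourier_coeff g k"
  using assms
  by (simp add: fourier_coeff_def distrib_right distrib_left integral_add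
      integrable_continuous_interval fourier_integrand_continuous flip: add_divide_distrib)

lemma fourier_coeff_cmult: "fourier_coeff (\<lambda>z. c * f z) k = c * fourier_coeff f k"
  by (simp add: fourier_coeff_def mult.assoc)

lemma fourier_sum_add:
  assumes "continuous_on circle f" "continuous_on circle g"
  shows "fourier_sum n (\<lambda>z. f z + g z) z = fourier_sum n f z + fourier_sum n g z"
  by (simp add: fourier_sum_def fourier_coeff_add assms distrib_right sum.distrib)

lemma fourier_sum_cmult: "fourier_sum n (\<lambda>z. c * f z) z = c * fourier_sum n f z"
  by (simp add: fourier_sum_def fourier_coeff_cmult sum_distrib_left mult.assoc)

lemma fourier_sum_sum:
  assumes "finite A" "\<And>a. a \<in> A \<Longrightarrow> continuous_on circle (f a)"
  shows "fourier_sum n (\<lambda>z. \<Sum>a\<in>A. f a z) z = (\<Sum>a\<in>A. fourier_sum n (f a) z)"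
  using assms
proof (induction A)
  case empty
  then show ?case
    by (simp add: fourier_sum_def fourier_coeff_def)
next
  case (insert a A)
  then show ?case
    by (simp add: fourier_sum_add continuous_on_sum)
qed

lemma fourier_sum_cong:
  assumes "\<And>z. z \<in> circle \<Longrightarrow> f z = g z"
  shows "fourier_sum n f z = fourier_sum n g z"
  using assms by (simp add: fourier_sum_def fourier_coeff_def)

lemma fourier_sum_powi:
  "fourier_sum n (\<lambda>z. z powi j) z = (if \<bar>j\<bar> \<le> int n then z powi j else 0)"
proof -
  have "fourier_sum n (\<lambda>z. z powi j) z =
      (\<Sum>k = - int n..int n. if k = j then z powi k else 0)"
    unfolding fourier_sum_def fourier_coeff_powi by (intro sum.cong) auto
  then show ?thesis
    by auto
qed

lemma fourier_sum_power: "fourier_sum n (\<lambda>z. z ^ j) z = (if j \<le> n then z ^ j else 0)"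
  using fourier_sum_powi [of n "int j" z] by (simp split: if_splits)

lemma norm_fourier_coeff_le:
  assumes "continuous_on circle f" "\<And>z. z \<in> circle \<Longrightarrow> cmod (f z) \<le> e"
  shows "cmod (fourier_coeff f k) \<le> e"
proof -
  have "cmod (integral {0..2 * pi} (\<lambda>s. f (cis s) * cis (- (of_int k * s)))) \<le> e * (2 * pi - 0)"
    using assms
    by (intro integral_bound fourier_integrand_continuous) (auto simp: norm_mult)
  then show ?thesis
    by (simp add: fourier_coeff_def norm_mult norm_divide field_simps)
qed

text \<open>
  The linear growth in \<open>n\<close> is harmless: the bound serves for the continuity of each single Fourier sum.
\<close>

lemma norm_fourier_sum_le:
  assumes "continuous_on circle f" "\<And>z. z \<in> circle \<Longrightarrow> cmod (f z) \<le> e" "z \<in> circle"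
  shows "cmod (fourier_sum n f z) \<le> (2 * real n + 1) * e"
proof -
  have "cmod (fourier_sum n f z) \<le> (\<Sum>k = - int n..int n. e)"
    unfolding fourier_sum_def using assms(3) norm_fourier_coeff_le [OF assms(1,2)]
    by (intro sum_norm_le) (simp add: norm_mult norm_power_int)
  then show ?thesis
    by simp
qed

lemma fourier_sum_diff:
  assumes "continuous_on circle f" "continuous_on circle g"
  shows "fourier_sum n (\<lambda>z. f z - g z) z = fourier_sum n f z - fourier_sum n g z"
proof -
  have "fourier_sum n (\<lambda>z. f z + (- 1) * g z) z = fourier_sum n f z + (- 1) * fourier_sum n g z"
    using assms by (subst fourier_sum_add) (auto simp only: fourier_sum_cmult intro!: continuous_intros)
  then show ?thesis
    by simp
qed

lemma continuous_on_fourier_sum: "continuous_on circle (fourier_sum n f)"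
  unfolding fourier_sum_def [abs_def] by (auto intro!: continuous_intros)


section \<open>Approximation by Laurent polynomials\<close>

text \<open>
  Trigonometric polynomials on the circle are written as Laurent polynomials with an explicit pole
  order at 0, so that their algebra is inherited from the library's polynomials.
\<close>

definition laurent :: "complex poly \<Rightarrow> nat \<Rightarrow> complex \<Rightarrow> complex" where
  "laurent P N z = poly P z / z ^ N"

lemma continuous_on_laurent: "E \<subseteq> circle \<Longrightarrow> continuous_on E (laurent P N)"
  unfolding laurent_def [abs_def] by (auto intro!: continuous_intros)

lemma fourier_sum_laurent:
  assumes "n \<ge> N + degree P" "z \<in> circle"
  shows "fourier_sum n (laurent P N) z = laurent P N z"
proof -
  have expand: "laurent P N z = (\<Sum>i\<le>degree P. coeff P i * z powi (int i - int N))"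
    if "z \<in> circle" for z
  proof -
    have "z \<noteq> 0"
      using that by auto
    then show ?thesis
      by (simp add: laurent_def poly_altdef sum_divide_distrib power_int_diff)
  qed
  have "fourier_sum n (laurent P N) z =
      fourier_sum n (\<lambda>z. \<Sum>i\<le>degree P. coeff P i * z powi (int i - int N)) z"
    by (intro fourier_sum_cong expand)
  also have "\<dots> = (\<Sum>i\<le>degree P. coeff P i * fourier_sum n (\<lambda>z. z powi (int i - int N)) z)"
    by (subst fourier_sum_sum) (auto simp: fourier_sum_cmult intro!: continuous_intros)
  also have "\<dots> = (\<Sum>i\<le>degree P. coeff P i * z powi (int i - int N))"
    using assms(1) by (intro sum.cong) (auto simp: fourier_sum_powi)
  finally show ?thesis
    using expand [OF assms(2)] by simp
qed

lemma laurent_add: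
  "z \<noteq> 0 \<Longrightarrow> laurent P N z + laurent Q M z = laurent (P * monom 1 M + Q * monom 1 N) (N + M) z"
  by (simp add: laurent_def poly_monom field_simps power_add)

lemma laurent_mult: "laurent P N z * laurent Q M z = laurent (P * Q) (N + M) z"
  by (simp add: laurent_def power_add)

lemma laurent_const: "laurent [:c:] 0 z = c"
  by (simp add: laurent_def)

text \<open>
  On the circle, \<open>Re z = (z + 1 / z) / 2\<close> and \<open>Im z = (z - 1 / z) / (2 * \<i>)\<close>; this is why real
  polynomials in the coordinates become Laurent polynomials.
\<close>

lemma real_polynomial_function_is_laurent:
  assumes "real_polynomial_function p"
  shows "\<exists>P N. \<forall>z\<in>circle. complex_of_real (p z) = laurent P N z"
  using assms
proof (induction p)
  case (linear p)
  interpret p: bounded_linear p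
    by fact
  have lin: "p z = p 1 * Re z + p \<i> * Im z" for z
  proof -
    have "p z = p (Re z *\<^sub>R 1 + Im z *\<^sub>R \<i>)"
      by (intro arg_cong [of _ _ p]) (simp add: complex_eq_iff)
    then show ?thesis
      by (simp add: p.add p.scaleR mult.commute)
  qed
  define \<alpha> \<beta> :: complex
    where "\<alpha> = (of_real (p 1) + \<i> * of_real (p \<i>)) / 2" and "\<beta> = (of_real (p 1) - \<i> * of_real (p \<i>)) / 2"
  have "complex_of_real (p z) = laurent [:\<alpha>, 0, \<beta>:] 1 z" if "z \<in> circle" for z
  proof -
    have zc: "z * cnj z = 1" and z0: "z \<noteq> 0"
      using that by (auto simp: complex_norm_square [symmetric])
    have "complex_of_real (p z) = \<alpha> * cnj z + \<beta> * z"
      unfolding lin [of z] \<alpha>_def \<beta>_def by (simp add: complex_eq_iff field_simps)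
    also have "\<dots> = (\<alpha> * (z * cnj z) + \<beta> * z * z) / z"
      using z0 by (simp add: field_simps)
    finally show ?thesis
      using z0 by (simp add: zc laurent_def field_simps)
  qed
  then show ?case
    by blast
next
  case (const c)
  then show ?case
    by (metis laurent_const)
next
  case (add p q)
  then obtain P N Q M where
    "\<forall>z\<in>circle. complex_of_real (p z) = laurent P N z"
    "\<forall>z\<in>circle. complex_of_real (q z) = laurent Q M z"
    by blast
  moreover have "laurent P N z + laurent Q M z = laurent (P * monom 1 M + Q * monom 1 N) (N + M) z"
    if "z \<in> circle" for z
    using that by (intro laurent_add) auto
  ultimately have "\<forall>z\<in>circle. complex_of_real (p z + q z) =
      laurent (P * monom 1 M + Q * monom 1 N) (N + M) z"
    by simp
  then show ?case
    by blast
next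
  case (mult p q)
  then obtain P N Q M where
    "\<forall>z\<in>circle. complex_of_real (p z) = laurent P N z"
    "\<forall>z\<in>circle. complex_of_real (q z) = laurent Q M z"
    by blast
  then have "\<forall>z\<in>circle. complex_of_real (p z * q z) = laurent (P * Q) (N + M) z"
    by (simp flip: laurent_mult)
  then show ?case
    by blast
qed

lemma laurent_approximation:
  assumes "compact E" "E \<subseteq> circle" "continuous_on E f" "e > 0"
  obtains P N where "\<And>z. z \<in> E \<Longrightarrow> cmod (f z - laurent P N z) < e"
proof -
  obtain g where g: "polynomial_function g" "\<And>z. z \<in> E \<Longrightarrow> cmod (f z - g z) < e"
    using Stone_Weierstrass_polynomial_function [OF assms(1,3,4)] by blast
  have "real_polynomial_function (\<lambda>z. Re (g z))" "real_polynomial_function (\<lambda>z. Im (g z))"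
    using g(1) bounded_linear_Re bounded_linear_Im
    unfolding polynomial_function_def o_def by blast+
  then obtain P N Q M where PQ:
    "\<forall>z\<in>circle. complex_of_real (Re (g z)) = laurent P N z"
    "\<forall>z\<in>circle. complex_of_real (Im (g z)) = laurent Q M z"
    using real_polynomial_function_is_laurent by meson
  let ?R = "P * monom 1 M + ([:\<i>:] * Q) * monom 1 N"
  have "g z = laurent ?R (N + M) z" if "z \<in> circle" for z
  proof -
    have "z \<noteq> 0"
      using that by auto
    have "g z = laurent P N z + \<i> * laurent Q M z"
      using PQ that complex_eq [of "g z"] by metis
    also have "\<i> * laurent Q M z = laurent ([:\<i>:] * Q) M z"
      by (simp add: laurent_def)
    finally show ?thesis
      using laurent_add [OF \<open>z \<noteq> 0\<close>] by simp
  qed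
  then show thesis
    using g(2) assms(2) by (intro that [of ?R "N + M"]) (metis subsetD)
qed

text \<open>
  Horner's scheme multiplies by \<open>z\<close>, which preserves errors on the circle; so coefficients can be
  adjusted one after another.
\<close>

lemma Poly_dense_approximation:
  fixes P :: "complex poly"
  assumes dense: "\<And>c \<delta>. \<delta> > 0 \<Longrightarrow> \<exists>d\<in>D. cmod (c - d) < \<delta>" and "e > 0"
  shows "\<exists>xs\<in>lists D. \<forall>z\<in>circle. cmod (poly P z - poly (Poly xs) z) < e"
  using \<open>e > 0\<close>
proof (induction P arbitrary: e)
  case 0
  then show ?case
    by (intro bexI [of _ "[]"]) auto
next
  case (pCons a P)
  obtain d where d: "d \<in> D" "cmod (a - d) < e / 2"
    using dense [of "e / 2" a] pCons.prems by auto
  obtain xs where xs: "xs \<in> lists D" "\<forall>z\<in>circle. cmod (poly P z - poly (Poly xs) z) < e / 2"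
    using pCons.IH [of "e / 2"] pCons.prems by auto
  have "cmod (poly (pCons a P) z - poly (Poly (d # xs)) z) < e" if "z \<in> circle" for z
  proof -
    have "poly (pCons a P) z - poly (Poly (d # xs)) z =
        (a - d) + z * (poly P z - poly (Poly xs) z)"
      by (simp add: algebra_simps)
    also have "cmod \<dots> \<le> cmod (a - d) + cmod (poly P z - poly (Poly xs) z)"
      using that by (intro norm_triangle_le) (simp add: norm_mult)
    also have "\<dots> < e"
      using d(2) bspec [OF xs(2) that] by simp
    finally show ?thesis .
  qed
  with d(1) xs(1) show ?case
    by (intro bexI [of _ "d # xs"]) auto
qed

text \<open>
  One countable family serves all compact subsets at once: Laurent polynomials with coefficients in a
  countable dense set of complex numbers.
\<close>

lemma countable_laurent_approximation:
  obtains \<G> :: "(complex \<Rightarrow> complex) set" where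
    "countable \<G>"
    "\<And>g. g \<in> \<G> \<Longrightarrow> continuous_on circle g"
    "\<And>E f e. \<lbrakk>compact E; E \<subseteq> circle; continuous_on E f; e > 0\<rbrakk>
       \<Longrightarrow> \<exists>g\<in>\<G>. \<forall>z\<in>E. cmod (f z - g z) < e"
proof -
  obtain D :: "complex set" where D: "countable D" "\<And>X. open X \<Longrightarrow> X \<noteq> {} \<Longrightarrow> \<exists>d\<in>D. d \<in> X"
    using countable_dense_setE by metis
  have dense: "\<exists>d\<in>D. cmod (c - d) < \<delta>" if "\<delta> > 0" for c \<delta>
    using D(2) [of "ball c \<delta>"] that by (auto simp: dist_norm)
  let ?\<G> = "(\<lambda>(xs, N). laurent (Poly xs) N) ` (lists D \<times> UNIV)"
  have "\<exists>g\<in>?\<G>. \<forall>z\<in>E. cmod (f z - g z) < e"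
    if E: "compact E" "E \<subseteq> circle" and f: "continuous_on E f" and "e > 0" for E f and e :: real
  proof -
    obtain P N where P: "\<And>z. z \<in> E \<Longrightarrow> cmod (f z - laurent P N z) < e / 2"
      using laurent_approximation [OF E f, of "e / 2"] \<open>e > 0\<close> by auto
    obtain xs where xs: "xs \<in> lists D" "\<forall>z\<in>circle. cmod (poly P z - poly (Poly xs) z) < e / 2"
      using Poly_dense_approximation [OF dense, of "e / 2" P] \<open>e > 0\<close> by auto
    have "cmod (f z - laurent (Poly xs) N z) < e" if "z \<in> E" for z
    proof -
      have "cmod (laurent P N z - laurent (Poly xs) N z) = cmod (poly P z - poly (Poly xs) z)"
        using that E(2) by (auto simp: laurent_def norm_divide norm_power simp flip: diff_divide_distrib)
      moreover have "cmod (poly P z - poly (Poly xs) z) < e / 2"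
        using xs(2) that E(2) by blast
      ultimately show ?thesis
        using P [OF that] norm_triangle_ineq [of "f z - laurent P N z" "laurent P N z - laurent (Poly xs) N z"]
        by simp
    qed
    with xs(1) show ?thesis
      by force
  qed
  moreover have "countable ?\<G>"
    using D(1) by (intro countable_image countable_SIGMA countable_lists) auto
  ultimately show thesis
    by (intro that [of ?\<G>]) (auto intro: continuous_on_laurent)
qed


section \<open>Small functions with prescribed Fourier sums on a finite set\<close>

text \<open>
  Summation by parts: multiplying by \<open>1 - z\<close> turns the sum into a telescoping one with decreasing
  coefficients. The term \<open>z ^ Suc n / n\<close> in the induction cancels the boundary
  contribution at the upper end.
\<close>

lemma norm_sum_power_over_index_le:
  fixes z :: complex
  assumes "cmod z = 1"
  shows "cmod (1 - z) * cmod (\<Sum>k\<in>{m<..n}. z ^ k / of_nat k) \<le> 2 / real (Suc m)"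
proof (cases "m < n")
  case True
  define S where "S n = (\<Sum>k\<in>{m<..n}. z ^ k / of_nat k)" for n
  have bound: "cmod ((1 - z) * S n + z ^ Suc n / of_nat n) \<le> 2 / real (Suc m) - 1 / real n"
    if "Suc m \<le> n" for n
    using that
  proof (induction n rule: dec_induct)
    case base
    have "{m<..Suc m} = {Suc m}"
      by auto
    then have "(1 - z) * S (Suc m) + z ^ Suc (Suc m) / of_nat (Suc m) = z ^ Suc m / of_nat (Suc m)"
      by (simp add: S_def algebra_simps diff_divide_distrib del: of_nat_Suc)
    then show ?case
      using assms by (simp add: norm_divide norm_power norm_mult del: of_nat_Suc)
  next
    case (step n)
    have "{m<..Suc n} = insert (Suc n) {m<..n}"
      using step.hyps by auto
    then have S: "S (Suc n) = S n + z ^ Suc n / of_nat (Suc n)"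
      by (simp add: S_def)
    have "(1 - z) * S (Suc n) + z ^ Suc (Suc n) / of_nat (Suc n) =
        ((1 - z) * S n + z ^ Suc n / of_nat n) - z ^ Suc n * of_real (1 / real n - 1 / real (Suc n))"
      unfolding S by (simp add: algebra_simps diff_divide_distrib del: of_nat_Suc)
    also have "cmod \<dots> \<le> cmod ((1 - z) * S n + z ^ Suc n / of_nat n) +
        cmod (z ^ Suc n * of_real (1 / real n - 1 / real (Suc n)))"
      by (rule norm_triangle_ineq4)
    also have "cmod (z ^ Suc n * of_real (1 / real n - 1 / real (Suc n))) =
        1 / real n - 1 / real (Suc n)"
      using step.hyps assms
      by (simp add: norm_mult norm_power frac_le del: of_real_diff of_real_divide of_nat_Suc)
    finally show ?case
      using step.IH by linarith
  qed
  have "cmod ((1 - z) * S n) \<le> cmod ((1 - z) * S n + z ^ Suc n / of_nat n) + cmod (z ^ Suc n / of_nat n)"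
    using norm_triangle_ineq4 [of "(1 - z) * S n + z ^ Suc n / of_nat n" "z ^ Suc n / of_nat n"] by simp
  moreover have "cmod (z ^ Suc n / of_nat n) = 1 / real n"
    using assms by (simp add: norm_divide norm_power norm_mult)
  ultimately show ?thesis
    using bound [of n] True by (simp add: norm_mult S_def)
qed auto

lemma norm_power_diff_one_le:
  fixes z :: complex
  assumes "cmod z = 1"
  shows "cmod (z ^ k - 1) \<le> real k * cmod (1 - z)"
proof -
  have "cmod (z ^ k - 1 ^ k) \<le> real k * cmod (z - 1)"
    using assms by (intro norm_power_diff) auto
  then show ?thesis
    by (simp add: norm_minus_commute)
qed

text \<open>
  On the circle, these are \<open>- 2 * \<i>\<close> times the partial sums of the sine series \<open>\<Sum>k. sin (k * t) / k\<close>. The cut at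
  \<open>1 / cmod (1 - z)\<close> balances the estimate \<open>\<bar>sin (k * t)\<bar> \<le> k * \<bar>t\<bar>\<close> for low frequencies against
  summation by parts for high ones.
\<close>

lemma norm_sine_sum_le:
  fixes z :: complex
  assumes "cmod z = 1"
  shows "cmod (\<Sum>k\<in>{0<..n}. (inverse z ^ k - z ^ k) / of_nat k) \<le> 6"
proof (cases "z = 1")
  case False
  define \<delta> where "\<delta> = cmod (1 - z)"
  define m where "m = nat \<lfloor>1 / \<delta>\<rfloor>"
  have "\<delta> > 0"
    using False by (simp add: \<delta>_def)
  have m: "real m \<le> 1 / \<delta>" "1 / \<delta> < real (Suc m)"
    using \<open>\<delta> > 0\<close> unfolding m_def by (simp, linarith)
  have z0: "z \<noteq> 0"
    using assms by auto
  have inv: "cmod (inverse z) = 1" "cmod (1 - inverse z) = \<delta>"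
  proof -
    show "cmod (inverse z) = 1"
      using assms by (simp add: norm_inverse)
    have "1 - inverse z = - (inverse z * (1 - z))"
      using z0 by (simp add: algebra_simps)
    then show "cmod (1 - inverse z) = \<delta>"
      using assms by (simp add: \<delta>_def norm_mult norm_inverse)
  qed
  let ?a = "\<lambda>k. (inverse z ^ k - z ^ k) / of_nat k"
  have low_term: "cmod (?a k) \<le> 2 * \<delta>" if "k > 0" for k
  proof -
    have "?a k = ((inverse z ^ k - 1) - (z ^ k - 1)) / of_nat k"
      by simp
    also have "cmod \<dots> \<le> (cmod (inverse z ^ k - 1) + cmod (z ^ k - 1)) / real k"
      using norm_triangle_ineq4 [of "inverse z ^ k - 1" "z ^ k - 1"]
      by (simp only: norm_divide norm_of_nat divide_right_mono of_nat_0_le_iff)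
    also have "\<dots> \<le> (real k * \<delta> + real k * \<delta>) / real k"
      using norm_power_diff_one_le [OF assms, of k] norm_power_diff_one_le [OF inv(1), of k] inv(2)
      by (intro divide_right_mono add_mono) (auto simp: \<delta>_def)
    finally show ?thesis
      using that by simp
  qed
  have low: "cmod (\<Sum>k\<in>A. ?a k) \<le> 2" if "A \<subseteq> {0<..m}" for A
  proof -
    have "cmod (\<Sum>k\<in>A. ?a k) \<le> (\<Sum>k\<in>A. 2 * \<delta>)"
      using that by (intro sum_norm_le low_term) auto
    also have "\<dots> \<le> (\<Sum>k\<in>{0<..m}. 2 * \<delta>)"
      using that \<open>\<delta> > 0\<close> by (intro sum_mono2) auto
    also have "\<dots> \<le> 2"
      using m(1) \<open>\<delta> > 0\<close> by (simp add: field_simps)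
    finally show ?thesis .
  qed
  have tail: "cmod (\<Sum>k\<in>{m<..n}. w ^ k / of_nat k) \<le> 2" if "cmod w = 1" "cmod (1 - w) = \<delta>" for w
  proof -
    have "\<delta> * cmod (\<Sum>k\<in>{m<..n}. w ^ k / of_nat k) \<le> 2 / real (Suc m)"
      using norm_sum_power_over_index_le [OF that(1), of m n] that(2) by simp
    also have "\<dots> \<le> \<delta> * 2"
      using m(2) \<open>\<delta> > 0\<close> by (simp add: field_simps)
    finally show ?thesis
      using \<open>\<delta> > 0\<close> by simp
  qed
  have high: "cmod (\<Sum>k\<in>{m<..n}. ?a k) \<le> 4"
  proof -
    have "(\<Sum>k\<in>{m<..n}. ?a k) =
        (\<Sum>k\<in>{m<..n}. inverse z ^ k / of_nat k) - (\<Sum>k\<in>{m<..n}. z ^ k / of_nat k)"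
      by (simp add: diff_divide_distrib sum_subtractf)
    also have "cmod \<dots> \<le> 2 + 2"
      using tail [OF inv] tail [OF assms \<delta>_def [symmetric]]
      by (intro order.trans [OF norm_triangle_ineq4] add_mono)
    finally show ?thesis
      by simp
  qed
  have "{0<..n} = {0<..min m n} \<union> {m<..n}"
    by auto
  then have "(\<Sum>k\<in>{0<..n}. ?a k) =
      (\<Sum>k\<in>{0<..min m n}. ?a k) + (\<Sum>k\<in>{m<..n}. ?a k)"
    by (metis (no_types, lifting) sum.union_disjoint finite_greaterThanAtMost
        ivl_disj_int_two(6) disjoint_iff greaterThanAtMost_iff min.boundedE not_le)
  also have "cmod \<dots> \<le> 2 + 4"
    by (intro order.trans [OF norm_triangle_ineq] add_mono low high) auto
  finally show ?thesis
    by simp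
qed auto

text \<open>
  Fejer's polynomials: the sine sums of order \<open>n\<close>, shifted in frequency by \<open>n\<close> so that the \<open>n\<close>-th
  Fourier sum keeps exactly the half with positive coefficients. They stay bounded, whereas
  this half is the harmonic number at 1 and, by summation by parts, stays bounded elsewhere.
\<close>

definition fejer :: "nat \<Rightarrow> complex \<Rightarrow> complex" where
  "fejer n z = (\<Sum>k\<in>{0<..n}. (z ^ (n - k) - z ^ (n + k)) / of_nat k)"

lemma norm_fejer_le:
  assumes "cmod z = 1"
  shows "cmod (fejer n z) \<le> 6"
proof -
  have "z \<noteq> 0"
    using assms by auto
  then have "fejer n z = z ^ n * (\<Sum>k\<in>{0<..n}. (inverse z ^ k - z ^ k) / of_nat k)"
    unfolding fejer_def sum_distrib_left
    by (intro sum.cong) (auto simp: power_diff power_add field_simps)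
  then show ?thesis
    using norm_sine_sum_le [OF assms] assms by (simp add: norm_mult norm_power)
qed

lemma continuous_on_fejer_mult: "continuous_on S (\<lambda>z. fejer n (b * z))"
  unfolding fejer_def divide_inverse by (intro continuous_intros)

lemma fourier_sum_fejer_mult:
  "fourier_sum n (\<lambda>z. fejer n (b * z)) z = (\<Sum>k\<in>{0<..n}. (b * z) ^ (n - k) / of_nat k)"
proof -
  let ?c = "\<lambda>k. b ^ (n - k) / of_nat k" and ?d = "\<lambda>k. - (b ^ (n + k)) / of_nat k"
  have "fourier_sum n (\<lambda>z. fejer n (b * z)) z =
      fourier_sum n (\<lambda>z. \<Sum>k\<in>{0<..n}. ?c k * z ^ (n - k) + ?d k * z ^ (n + k)) z"
    unfolding fejer_def
    by (intro arg_cong2 [of _ _ _ _ "fourier_sum n"] ext sum.cong refl)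
      (simp add: power_mult_distrib diff_divide_distrib)
  also have "\<dots> = (\<Sum>k\<in>{0<..n}. fourier_sum n (\<lambda>z. ?c k * z ^ (n - k) + ?d k * z ^ (n + k)) z)"
    by (intro fourier_sum_sum) (auto intro!: continuous_intros)
  also have "\<dots> = (\<Sum>k\<in>{0<..n}. ?c k * fourier_sum n (\<lambda>z. z ^ (n - k)) z +
        ?d k * fourier_sum n (\<lambda>z. z ^ (n + k)) z)"
    unfolding fourier_sum_cmult [symmetric]
    by (intro sum.cong refl fourier_sum_add continuous_intros)
  also have "\<dots> = (\<Sum>k\<in>{0<..n}. (b * z) ^ (n - k) / of_nat k)"
    by (intro sum.cong) (auto simp: fourier_sum_power power_mult_distrib)
  finally show ?thesis .
qed

lemma harm_divide_tendsto_0: "(\<lambda>n. c / harm n) \<longlonglongrightarrow> (0::real)"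
  by (intro tendsto_divide_0 [OF tendsto_const] filterlim_at_top_imp_at_infinity harm_at_top)

text \<open>
  The factor \<open>b\<close> rotates the distinguished point from 1 to \<open>inverse b\<close>. Elsewhere a bounded numerator meets
  the divergent harmonic numbers.
\<close>

lemma fourier_sum_fejer_over_harm_tendsto:
  assumes "cmod b = 1" "cmod z = 1"
  shows "(\<lambda>n. fourier_sum n (\<lambda>z. fejer n (b * z)) z / harm n) \<longlonglongrightarrow> (if b * z = 1 then 1 else 0)"
proof (cases "b * z = 1")
  case True
  have "{0<..n} = {1..n}" for n :: nat
    by auto
  then have "fourier_sum n (\<lambda>z. fejer n (b * z)) z = harm n" for n
    using True by (simp add: fourier_sum_fejer_mult harm_def inverse_eq_divide)
  moreover have "\<forall>\<^sub>F n in sequentially. harm n / harm n = (1::complex)"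
  proof (intro eventually_mono [OF eventually_gt_at_top [of 0]])
    fix n :: nat
    assume "n > 0"
    then have "harm n \<noteq> (0::complex)"
      using harm_pos_iff [of n, where 'a = real] by (metis norm_harm norm_zero less_irrefl)
    then show "harm n / harm n = (1::complex)"
      by simp
  qed
  ultimately show ?thesis
    using True by (simp add: tendsto_eventually)
next
  case False
  define u where "u = inverse (b * z)"
  have bz: "cmod (b * z) = 1" "b * z \<noteq> 0"
    using assms by (auto simp: norm_mult)
  then have u: "cmod u = 1" "u \<noteq> 1"
    using False unfolding u_def by (auto simp only: norm_inverse inverse_1 inverse_eq_1_iff)
  have "cmod (fourier_sum n (\<lambda>z. fejer n (b * z)) z) \<le> 2 / cmod (1 - u)" for n
  proof -
    have "fourier_sum n (\<lambda>z. fejer n (b * z)) z = (b * z) ^ n * (\<Sum>k\<in>{0<..n}. u ^ k / of_nat k)"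
      unfolding fourier_sum_fejer_mult sum_distrib_left u_def using bz(2)
      by (intro sum.cong) (simp_all add: power_diff field_simps)
    then have "cmod (fourier_sum n (\<lambda>z. fejer n (b * z)) z) = cmod (\<Sum>k\<in>{0<..n}. u ^ k / of_nat k)"
      by (simp add: norm_mult norm_power assms)
    then show ?thesis
      using norm_sum_power_over_index_le [OF u(1), of 0 n] u(2) by (simp add: field_simps)
  qed
  then have "cmod (fourier_sum n (\<lambda>z. fejer n (b * z)) z / harm n) \<le> (2 / cmod (1 - u)) / harm n" for n
    by (simp only: norm_divide norm_harm divide_right_mono harm_nonneg)
  then have "(\<lambda>n. fourier_sum n (\<lambda>z. fejer n (b * z)) z / harm n) \<longlonglongrightarrow> 0"
    by (intro Lim_null_comparison [OF _ harm_divide_tendsto_0] always_eventually allI)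
  then show ?thesis
    using False by simp
qed

text \<open>
  A polynomial of Fejer rotated to \<open>a\<close> and divided by the harmonic number is uniformly small, while its
  Fourier sum tends to 1 at \<open>a\<close> and to 0 at the other points. Weighted by \<open>w a\<close> and summed over \<open>a\<close>, these
  interpolate \<open>w\<close> in the limit.
\<close>

lemma small_function_with_prescribed_fourier_sum:
  assumes F: "finite F" "F \<subseteq> circle" and "\<epsilon> > 0" "\<delta> > 0"
  obtains n h where "n \<ge> N" "continuous_on circle h"
    "\<And>z. z \<in> circle \<Longrightarrow> cmod (h z) < \<epsilon>"
    "\<And>z. z \<in> F \<Longrightarrow> cmod (fourier_sum n h z - w z) < \<delta>"
proof -
  define h where "h n z = (\<Sum>a\<in>F. w a / harm n * fejer n (cnj a * z))" for n z
  have cont: "continuous_on S (h n)" for S n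
    unfolding h_def by (intro continuous_intros continuous_on_fejer_mult)
  have h_le: "cmod (h n z) \<le> (\<Sum>a\<in>F. cmod (w a) * 6) / harm n" if "z \<in> circle" for n z
  proof -
    have "cmod (h n z) \<le> (\<Sum>a\<in>F. cmod (w a) / harm n * 6)"
      unfolding h_def using F(2) that
      by (intro sum_norm_le)
        (auto simp: norm_mult norm_divide norm_harm harm_nonneg
          intro!: divide_right_mono mult_left_mono norm_fejer_le)
    then show ?thesis
      by (simp add: sum_divide_distrib)
  qed
  have lim: "(\<lambda>n. fourier_sum n (h n) z) \<longlonglongrightarrow> w z" if "z \<in> F" for z
  proof -
    have conj_mult: "cnj a * z = 1 \<longleftrightarrow> a = z" if "a \<in> F" for a
    proof -
      have a: "cnj a * a = 1" "cnj a \<noteq> 0"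
        using F(2) that by (auto simp: mult.commute complex_norm_square [symmetric])
      then show ?thesis
        by (metis mult_left_cancel)
    qed
    have "(\<lambda>n. \<Sum>a\<in>F. w a * (fourier_sum n (\<lambda>z. fejer n (cnj a * z)) z / harm n)) \<longlonglongrightarrow>
        (\<Sum>a\<in>F. w a * (if cnj a * z = 1 then 1 else 0))"
      using F(2) that
      by (intro tendsto_sum tendsto_mult tendsto_const fourier_sum_fejer_over_harm_tendsto) auto
    moreover have "(\<Sum>a\<in>F. w a * (if cnj a * z = 1 then 1 else 0)) = (\<Sum>a\<in>F. if a = z then w a else 0)"
      using conj_mult by (intro sum.cong) auto
    moreover have "fourier_sum n (h n) z =
        (\<Sum>a\<in>F. w a * (fourier_sum n (\<lambda>z. fejer n (cnj a * z)) z / harm n))" for n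
    proof -
      have "fourier_sum n (h n) z =
          (\<Sum>a\<in>F. w a / harm n * fourier_sum n (\<lambda>z. fejer n (cnj a * z)) z)"
        unfolding h_def fourier_sum_cmult [symmetric]
        by (intro fourier_sum_sum F(1) continuous_on_mult continuous_on_const continuous_on_fejer_mult)
      then show ?thesis
        by simp
    qed
    ultimately show ?thesis
      using F(1) that by simp
  qed
  have "\<forall>\<^sub>F n in sequentially. (\<Sum>a\<in>F. cmod (w a) * 6) / harm n < \<epsilon>"
    using order_tendstoD(2) [OF harm_divide_tendsto_0 \<open>\<epsilon> > 0\<close>] .
  moreover have "\<forall>\<^sub>F n in sequentially. \<forall>z\<in>F. cmod (fourier_sum n (h n) z - w z) < \<delta>"
    using tendstoD [OF lim \<open>\<delta> > 0\<close>] F(1) by (simp add: eventually_ball_finite dist_norm)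
  ultimately have "\<forall>\<^sub>F n in sequentially. n \<ge> N \<and> (\<Sum>a\<in>F. cmod (w a) * 6) / harm n < \<epsilon> \<and>
      (\<forall>z\<in>F. cmod (fourier_sum n (h n) z - w z) < \<delta>)"
    using eventually_ge_at_top [of N] by eventually_elim auto
  then obtain n where "n \<ge> N" "(\<Sum>a\<in>F. cmod (w a) * 6) / harm n < \<epsilon>"
    "\<forall>z\<in>F. cmod (fourier_sum n (h n) z - w z) < \<delta>"
    using eventually_happens' [OF sequentially_bot] by blast
  then show thesis
    using h_le le_less_trans by (intro that [of n "h n"] cont) (blast | metis)+
qed


section \<open>Residual sets in metric spaces\<close>

lemma openin_mtopology_of:
  "openin (mtopology_of m) U \<longleftrightarrow>
     U \<subseteq> mspace m \<and> (\<forall>x\<in>U. \<exists>r>0. \<forall>y\<in>mspace m. mdist m x y < r \<longrightarrow> y \<in> U)"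
proof -
  interpret Metric_space "mspace m" "mdist m"
    by simp
  have "mball x r \<subseteq> U \<longleftrightarrow> (\<forall>y\<in>mspace m. mdist m x y < r \<longrightarrow> y \<in> U)" if "x \<in> mspace m" for x r
    using that by (auto simp: subset_iff)
  then have "(\<forall>x\<in>U. \<exists>r>0. mball x r \<subseteq> U) \<longleftrightarrow>
      (\<forall>x\<in>U. \<exists>r>0. \<forall>y\<in>mspace m. mdist m x y < r \<longrightarrow> y \<in> U)" if "U \<subseteq> mspace m"
    by (intro ball_cong refl) (simp add: subsetD [OF that])
  then show ?thesis
    unfolding mtopology_of_def openin_mtopology Ball_def [of U] by argo
qed

lemma dense_in_mspace_iff:
  "mtopology_of m closure_of S = mspace m \<longleftrightarrow>
     (\<forall>x\<in>mspace m. \<forall>r>0. \<exists>y\<in>S. y \<in> mspace m \<and> mdist m x y < r)"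
proof -
  interpret Metric_space "mspace m" "mdist m"
    by simp
  have "mtopology_of m closure_of S =
      {x \<in> mspace m. \<forall>r>0. \<exists>y\<in>S. y \<in> mspace m \<and> mdist m x y < r}"
    unfolding mtopology_of_def metric_closure_of by auto
  then show ?thesis
    by blast
qed

text \<open>
  The G-delta set is dense as soon as all members of the family share one dense set; for generic
  compact sets this is the family of nonempty finite subsets of a dense set.
\<close>

lemma quasi_all_if_dense_subset:
  assumes "countable \<U>" "\<And>U. U \<in> \<U> \<Longrightarrow> openin (mtopology_of m) U"
    and "D \<subseteq> mspace m" "D \<subseteq> \<Inter>\<U>" "mtopology_of m closure_of D = mspace m"
    and "\<And>x. \<lbrakk>x \<in> mspace m; x \<in> \<Inter>\<U>\<rbrakk> \<Longrightarrow> P x"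
  shows "quasi_all m P"
proof -
  define G where "G = \<Inter>(insert (mspace m) \<U>)"
  have "openin (mtopology_of m) (mspace m)"
    using openin_topspace [of "mtopology_of m"] by simp
  then have "gdelta_in (mtopology_of m) G"
    unfolding G_def using assms(1,2) by (intro gdelta_in_Inter) (auto intro: open_imp_gdelta_in)
  moreover have "mtopology_of m closure_of G = topspace (mtopology_of m)"
  proof -
    have "D \<subseteq> G"
      using assms(3,4) by (auto simp: G_def)
    then have "mspace m \<subseteq> mtopology_of m closure_of G"
      using closure_of_mono [of D G "mtopology_of m"] assms(5) by simp
    then show ?thesis
      using closure_of_subset_topspace [of "mtopology_of m" G] by auto
  qed
  moreover have "G \<subseteq> {x \<in> mspace m. P x}"
    using assms(6) by (auto simp: G_def)
  ultimately show ?thesis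
    unfolding quasi_all_def residual_in_def by auto
qed

lemma quasi_all_Baire:
  assumes "mcomplete_of m" "countable \<U>"
    and "\<And>U. U \<in> \<U> \<Longrightarrow> openin (mtopology_of m) U"
    and "\<And>U. U \<in> \<U> \<Longrightarrow> mtopology_of m closure_of U = mspace m"
    and "\<And>x. \<lbrakk>x \<in> mspace m; x \<in> \<Inter>\<U>\<rbrakk> \<Longrightarrow> P x"
  shows "quasi_all m P"
proof (rule quasi_all_if_dense_subset)
  let ?\<V> = "insert (mspace m) \<U>"
  have "mtopology_of m closure_of \<Inter>?\<V> = mspace m"
    unfolding mtopology_of_def
  proof (rule Metric_space.metric_Baire_category [OF Metric_space_mspace_mdist])
    show "Metric_space.mcomplete (mspace m) (mdist m)"
      using assms(1) by (simp add: mcomplete_of_def)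
    fix U
    assume "U \<in> ?\<V>"
    moreover have "openin (mtopology_of m) (mspace m)" "mtopology_of m closure_of mspace m = mspace m"
      using openin_topspace [of "mtopology_of m"] closure_of_topspace [of "mtopology_of m"] by simp_all
    ultimately show "openin (Metric_space.mtopology (mspace m) (mdist m)) U \<and>
        Metric_space.mtopology (mspace m) (mdist m) closure_of U = mspace m"
      using assms(3,4) by (auto simp: mtopology_of_def)
  qed (use assms(2) in simp)
  then show "mtopology_of m closure_of \<Inter>?\<V> = mspace m" .
  show "\<Inter>?\<V> \<subseteq> mspace m" "\<Inter>?\<V> \<subseteq> \<Inter>\<U>"
    by auto
qed (fact assms)+


section \<open>The Hausdorff metric\<close>

lemma infdist_le_hausdorff_dist:
  assumes "A \<in> compacts S" "B \<in> compacts S" "b \<in> B"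
  shows "infdist b A \<le> hausdorff_dist A B"
  using hausdorff_dist_le_iff [of A B "hausdorff_dist A B"] assms by (auto dest: compacts_UNIV)

text \<open>
  A compact set inside an open set has a whole neighbourhood of positive radius inside it, and this
  neighbourhood contains all compact sets at a smaller Hausdorff distance.
\<close>

lemma openin_hausdorff_subset:
  assumes "openin (top_of_set S) U"
  shows "openin (mtopology_of (hausdorff_metric S)) {E \<in> compacts S. E \<subseteq> U}"
  unfolding openin_mtopology_of mspace_hausdorff_metric mdist_hausdorff_metric
proof (intro conjI ballI)
  fix E
  assume E: "E \<in> {E \<in> compacts S. E \<subseteq> U}"
  obtain V where V: "open V" "U = S \<inter> V"
    using assms by (auto simp: openin_open)
  obtain r where r: "r > 0" "(\<Union>x\<in>E. ball x r) \<subseteq> V"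
    using compact_subset_open_imp_ball_epsilon_subset [of E V] E V by (auto simp: compacts_def)
  have "E' \<subseteq> U" if E': "E' \<in> compacts S" "hausdorff_dist E E' < r" for E'
  proof
    fix y
    assume "y \<in> E'"
    have ne: "E \<noteq> {}"
      using E by (auto simp: compacts_def)
    have "infdist y E < r"
      using infdist_le_hausdorff_dist [of E S E' y] E E' \<open>y \<in> E'\<close> by auto
    then obtain x where "x \<in> E" "dist y x < r"
      using cINF_less_iff [OF ne, of "dist y" r] by (auto simp: infdist_notempty [OF ne])
    then have "y \<in> V"
      using r(2) by (force simp: dist_commute)
    then show "y \<in> U"
      using V(2) E'(1) \<open>y \<in> E'\<close> by (auto simp: compacts_def)
  qed
  then show "\<exists>r>0. \<forall>E'\<in>compacts S. hausdorff_dist E E' < r \<longrightarrow> E' \<in> {E \<in> compacts S. E \<subseteq> U}"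
    using r(1) by (intro exI [of _ r]) simp
qed simp

text \<open>
  The points of a finite net of a compact set can be moved into \<open>D\<close>. The net is taken at scale \<open>r / 4\<close>, so
  that both sources of error add up to \<open>r / 2\<close>, which is strictly below \<open>r\<close>.
\<close>

lemma finite_subsets_dense_hausdorff:
  assumes "D \<subseteq> S" "S \<subseteq> closure D"
  shows "mtopology_of (hausdorff_metric S) closure_of {F. finite F \<and> F \<noteq> {} \<and> F \<subseteq> D} = compacts S"
proof -
  have "\<exists>F\<in>{F. finite F \<and> F \<noteq> {} \<and> F \<subseteq> D}. F \<in> compacts S \<and> hausdorff_dist E F < r"
    if E: "E \<in> compacts S" and "r > 0" for E and r :: real
  proof -
    have "compact E" "E \<noteq> {}"
      using E by (auto simp: compacts_def)
    have cover: "E \<subseteq> (\<Union>x\<in>E. ball x (r / 4))"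
      using \<open>r > 0\<close> by auto
    have "\<exists>C. C \<subseteq> E \<and> finite C \<and> E \<subseteq> (\<Union>x\<in>C. ball x (r / 4))"
      by (rule compactE_image [OF \<open>compact E\<close> _ cover]) (simp, blast)
    then obtain C where C: "C \<subseteq> E" "finite C" "E \<subseteq> (\<Union>x\<in>C. ball x (r / 4))"
      by (elim exE conjE)
    have "\<exists>d\<in>D. dist d x < r / 4" if "x \<in> C" for x
    proof -
      have "x \<in> closure D"
        using that C(1) E assms(2) by (auto simp: compacts_def)
      then show ?thesis
        using \<open>r > 0\<close> unfolding closure_approachable by (metis divide_pos_pos zero_less_numeral)
    qed
    then obtain d where d: "\<And>x. x \<in> C \<Longrightarrow> d x \<in> D" "\<And>x. x \<in> C \<Longrightarrow> dist (d x) x < r / 4"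
      by metis
    have "C \<noteq> {}"
      using C(3) \<open>E \<noteq> {}\<close> by auto
    then have F: "d ` C \<in> {F. finite F \<and> F \<noteq> {} \<and> F \<subseteq> D}" "d ` C \<in> compacts S"
      using C(2) d(1) assms(1) by (auto simp: compacts_def finite_imp_compact)
    have "infdist y (d ` C) \<le> r / 2" if "y \<in> E" for y
    proof -
      obtain x where "x \<in> C" "dist x y < r / 4"
        using subsetD [OF C(3) \<open>y \<in> E\<close>] unfolding UN_iff mem_ball by blast
      then have "dist y (d x) \<le> r / 2"
        using d(2) [of x] dist_triangle [of y "d x" x] by (simp add: dist_commute)
      then show ?thesis
        using \<open>x \<in> C\<close> by (intro infdist_le2) auto
    qed
    moreover have "infdist y E \<le> r / 2" if "y \<in> d ` C" for y
    proof -
      obtain x where x: "x \<in> C" "y = d x"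
        using \<open>y \<in> d ` C\<close> by auto
      then show ?thesis
        using C(1) d(2) [of x] \<open>r > 0\<close> by (intro infdist_le2 [of x]) auto
    qed
    ultimately have "hausdorff_dist E (d ` C) \<le> r / 2"
      using E F(2) by (subst hausdorff_dist_le_iff) (auto dest: compacts_UNIV)
    then show ?thesis
      using F \<open>r > 0\<close> by (intro bexI [of _ "d ` C"]) auto
  qed
  then show ?thesis
    using dense_in_mspace_iff [of "hausdorff_metric S"] by simp
qed


section \<open>Generic functions and generic compact sets\<close>

lemma mcomplete_of_C_metric: "mcomplete_of (C_metric E)"
proof -
  have "mcomplete_of (cfunspace (top_of_set E) (Met_TC.Self :: complex metric))"
    by (intro Met_TC.mcomplete_cfunspace) (simp add: complete_UNIV)
  then show ?thesis
    by (simp add: C_metric_def Met_TC.Self_def euclidean_metric_def)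
qed

lemma mdist_C_metric_le:
  assumes "E \<noteq> {}" "f \<in> mspace (C_metric E)" "g \<in> mspace (C_metric E)"
    and "\<And>z. z \<in> E \<Longrightarrow> cmod (f z - g z) \<le> e"
  shows "mdist (C_metric E) f g \<le> e"
  using assms by (simp add: mdist_C_metric cSUP_least)

lemma norm_diff_le_mdist_C_metric:
  assumes "compact E" "f \<in> mspace (C_metric E)" "g \<in> mspace (C_metric E)" "z \<in> E"
  shows "cmod (f z - g z) \<le> mdist (C_metric E) f g"
proof -
  have "continuous_on E (\<lambda>z. cmod (f z - g z))"
    using assms by (auto simp: mspace_C_metric intro!: continuous_intros)
  then have "bdd_above ((\<lambda>z. cmod (f z - g z)) ` E)"
    using assms(1) by (intro bounded_imp_bdd_above compact_imp_bounded compact_continuous_image)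
  then show ?thesis
    using assms by (subst mdist_C_metric) (auto intro: cSUP_upper)
qed

text \<open>
  The condition only involves one Fourier sum on finitely many points, and each Fourier sum depends
  continuously on the function.
\<close>

lemma openin_fourier_sum_close:
  assumes "finite F" "F \<subseteq> circle"
  shows "openin (mtopology_of (C_metric circle))
    {f \<in> mspace (C_metric circle). \<exists>n. \<forall>z\<in>F. cmod (fourier_sum n f z - g z) < e}"
    (is "openin _ ?V")
  unfolding openin_mtopology_of
proof (intro conjI ballI)
  fix f
  assume "f \<in> ?V"
  then obtain n where f: "f \<in> mspace (C_metric circle)"
    and n: "\<And>z. z \<in> F \<Longrightarrow> cmod (fourier_sum n f z - g z) < e"
    by auto
  \<comment> \<open>the smallest margin left on \<open>F\<close>; the 1 covers the case that \<open>F\<close> is empty\<close>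
  define \<delta> where "\<delta> = Min (insert 1 ((\<lambda>z. e - cmod (fourier_sum n f z - g z)) ` F))"
  have "\<delta> > 0"
    unfolding \<delta>_def using assms(1) n by (subst Min_gr_iff) auto
  have \<delta>: "cmod (fourier_sum n f z - g z) \<le> e - \<delta>" if "z \<in> F" for z
  proof -
    have "\<delta> \<le> e - cmod (fourier_sum n f z - g z)"
      unfolding \<delta>_def using assms(1) that by (intro Min_le) auto
    then show ?thesis
      by simp
  qed
  have "f' \<in> ?V" if f': "f' \<in> mspace (C_metric circle)"
    and dist: "mdist (C_metric circle) f f' < \<delta> / (2 * real n + 1)" for f'
  proof -
    have cont: "continuous_on circle f" "continuous_on circle f'"
      using f f' by (auto simp: mspace_C_metric)
    have "cmod (fourier_sum n f' z - g z) < e" if "z \<in> F" for z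
    proof -
      have "cmod (fourier_sum n f' z - fourier_sum n f z) \<le>
          (2 * real n + 1) * mdist (C_metric circle) f f'"
        unfolding norm_minus_commute [of "fourier_sum n f' z"] fourier_sum_diff [OF cont, symmetric]
        using that assms(2)
        by (intro norm_fourier_sum_le continuous_on_diff cont norm_diff_le_mdist_C_metric [OF _ f f'])
          auto
      also have "\<dots> < \<delta>"
        using dist by (simp add: field_simps)
      finally show ?thesis
        using \<delta> [OF that] norm_triangle_ineq [of "fourier_sum n f' z - fourier_sum n f z" "fourier_sum n f z - g z"]
        by simp
    qed
    with f' show ?thesis
      by auto
  qed
  moreover have "\<delta> / (2 * real n + 1) > 0"
    using \<open>\<delta> > 0\<close> by simp
  ultimately show "\<exists>r>0. \<forall>f'\<in>mspace (C_metric circle). mdist (C_metric circle) f f' < r \<longrightarrow> f' \<in> ?V"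
    by blast
qed auto

text \<open>
  A given function is approximated by a Laurent polynomial \<open>p\<close>, which agrees with its Fourier sums of
  large order; a small perturbation then moves one of these close to \<open>g\<close> on the finite set.
\<close>

lemma dense_fourier_sum_close:
  assumes "finite F" "F \<subseteq> circle" "e > 0"
  shows "mtopology_of (C_metric circle) closure_of
      {f \<in> mspace (C_metric circle). \<exists>n. \<forall>z\<in>F. cmod (fourier_sum n f z - g z) < e} =
    mspace (C_metric circle)"
    (is "_ closure_of ?V = _")
  unfolding dense_in_mspace_iff
proof (intro ballI allI impI)
  fix f and r :: real
  assume f: "f \<in> mspace (C_metric circle)" and "r > 0"
  obtain P N where P: "\<And>z. z \<in> circle \<Longrightarrow> cmod (f z - laurent P N z) < r / 4"
    using laurent_approximation [of circle f "r / 4"] f \<open>r > 0\<close> by (auto simp: mspace_C_metric)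
  obtain n h where n: "n \<ge> N + degree P" and h: "continuous_on circle h"
    "\<And>z. z \<in> circle \<Longrightarrow> cmod (h z) < r / 4"
    "\<And>z. z \<in> F \<Longrightarrow> cmod (fourier_sum n h z - (g z - laurent P N z)) < e"
    using small_function_with_prescribed_fourier_sum
      [OF assms(1,2), of "r / 4" e "N + degree P" "\<lambda>z. g z - laurent P N z"] \<open>r > 0\<close> \<open>e > 0\<close>
    by auto
  define f' where "f' = restrict (\<lambda>z. laurent P N z + h z) circle"
  have "continuous_on circle (\<lambda>z. laurent P N z + h z)"
    using h(1) by (intro continuous_intros continuous_on_laurent) auto
  then have f': "f' \<in> mspace (C_metric circle)"
    using continuous_on_cong [of circle circle f' "\<lambda>z. laurent P N z + h z"]
    by (simp add: mspace_C_metric f'_def)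
  have "fourier_sum n f' z = laurent P N z + fourier_sum n h z" if "z \<in> F" for z
  proof -
    have "fourier_sum n f' z = fourier_sum n (\<lambda>z. laurent P N z + h z) z"
      unfolding f'_def by (intro fourier_sum_cong) auto
    then show ?thesis
      using h(1) n that assms(2)
      by (auto simp: fourier_sum_add continuous_on_laurent fourier_sum_laurent)
  qed
  then have "f' \<in> ?V"
    using f' h(3) by (auto simp: algebra_simps intro!: exI [of _ n])
  moreover have "mdist (C_metric circle) f f' \<le> r / 2"
  proof (intro mdist_C_metric_le f f')
    fix z :: complex
    assume z: "z \<in> circle"
    have "cmod (f z - f' z) \<le> cmod (f z - laurent P N z) + cmod (h z)"
      using z norm_triangle_ineq4 [of "f z - laurent P N z" "h z"] by (simp add: f'_def algebra_simps)
    then show "cmod (f z - f' z) \<le> r / 2"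
      using P [OF z] h(2) [OF z] by linarith
  qed auto
  ultimately show "\<exists>y\<in>?V. y \<in> mspace (C_metric circle) \<and> mdist (C_metric circle) f y < r"
    using \<open>r > 0\<close> f' by (intro bexI [of _ f']) auto
qed

lemma uniformly_universal_onI:
  assumes E: "E \<in> compacts circle"
    and \<G>: "\<And>f e. \<lbrakk>continuous_on E f; e > 0\<rbrakk> \<Longrightarrow> \<exists>g\<in>\<G>. \<forall>z\<in>E. cmod (f z - g z) < e"
    and close: "\<And>g m. g \<in> \<G> \<Longrightarrow> \<exists>n. \<forall>z\<in>E. cmod (fourier_sum n f z - g z) < 1 / real (Suc m)"
  shows "uniformly_universal_on E (\<lambda>n. fourier_sum n f)"
  unfolding uniformly_universal_on_def dense_in_mspace_iff
proof (intro ballI allI impI)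
  fix \<phi> and r :: real
  assume \<phi>: "\<phi> \<in> mspace (C_metric E)" and "r > 0"
  have comp: "compact E" "E \<noteq> {}" "E \<subseteq> circle"
    using E by (auto simp: compacts_def)
  obtain g where g: "g \<in> \<G>" "\<forall>z\<in>E. cmod (\<phi> z - g z) < r / 4"
    using \<G> [of \<phi> "r / 4"] \<phi> \<open>r > 0\<close> comp by (auto simp: mspace_C_metric)
  obtain m where m: "1 / real (Suc m) < r / 4"
    using nat_approx_posE [of "r / 4"] \<open>r > 0\<close> by auto
  obtain n where n: "\<forall>z\<in>E. cmod (fourier_sum n f z - g z) < 1 / real (Suc m)"
    using close [OF g(1)] by blast
  let ?s = "restrict (fourier_sum n f) E"
  have s: "?s \<in> mspace (C_metric E)"
    using comp by (intro restrict_fourier_sum_in_C)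
  have "mdist (C_metric E) \<phi> ?s \<le> r / 2"
  proof (intro mdist_C_metric_le \<phi> s comp)
    fix z
    assume z: "z \<in> E"
    have "cmod (\<phi> z - ?s z) \<le> cmod (\<phi> z - g z) + cmod (fourier_sum n f z - g z)"
      using z norm_triangle_ineq4 [of "\<phi> z - g z" "fourier_sum n f z - g z"] by simp
    then show "cmod (\<phi> z - ?s z) \<le> r / 2"
      using bspec [OF g(2) z] bspec [OF n z] m by linarith
  qed
  with s \<open>r > 0\<close> show "\<exists>y\<in>range (\<lambda>n. restrict (fourier_sum n f) E).
      y \<in> mspace (C_metric E) \<and> mdist (C_metric E) \<phi> y < r"
    by (intro bexI [of _ ?s]) auto
qed

text \<open>
  Closeness of a continuous Fourier sum to a continuous target persists on a neighbourhood of the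
  compact set, so it is an open condition on the set. If it can be met on each finite subset of a
  dense set, it can therefore be met on a dense open family of compact sets.
\<close>

lemma quasi_all_universal_if_close_on_finite:
  assumes \<G>: "countable \<G>" "\<And>g. g \<in> \<G> \<Longrightarrow> continuous_on circle g"
    "\<And>E \<phi> e. \<lbrakk>compact E; E \<subseteq> circle; continuous_on E \<phi>; e > 0\<rbrakk>
       \<Longrightarrow> \<exists>g\<in>\<G>. \<forall>z\<in>E. cmod (\<phi> z - g z) < e"
    and D: "D \<subseteq> circle" "circle \<subseteq> closure D"
    and close: "\<And>F g m. \<lbrakk>finite F; F \<subseteq> D; g \<in> \<G>\<rbrakk>
       \<Longrightarrow> \<exists>n. \<forall>z\<in>F. cmod (fourier_sum n f z - g z) < 1 / real (Suc m)"
  shows "quasi_all (hausdorff_metric circle) (\<lambda>E. uniformly_universal_on E (\<lambda>n. fourier_sum n f))"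
proof -
  let ?F = "{F. finite F \<and> F \<noteq> {} \<and> F \<subseteq> D}"
  define W where "W = (\<lambda>(g, m). {E \<in> compacts circle.
    \<exists>n. \<forall>z\<in>E. cmod (fourier_sum n f z - g z) < 1 / real (Suc m)})"
  have openW: "openin (mtopology_of (hausdorff_metric circle)) (W (g, m))" if "g \<in> \<G>" for g m
  proof -
    let ?U = "\<lambda>n. {z \<in> circle. cmod (fourier_sum n f z - g z) < 1 / real (Suc m)}"
    have "W (g, m) = (\<Union>n. {E \<in> compacts circle. E \<subseteq> ?U n})"
      by (fastforce simp: W_def compacts_def)
    moreover have "openin (top_of_set circle) (?U n)" for n
    proof -
      have "continuous_on circle (\<lambda>z. cmod (fourier_sum n f z - g z))"
        by (intro continuous_intros continuous_on_fourier_sum \<G>(2) that)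
      then show ?thesis
        using continuous_openin_preimage_gen [of circle _ "{..<1 / real (Suc m)}"]
        by (simp add: vimage_def Int_def)
    qed
    ultimately show ?thesis
      by (simp only:, intro openin_Union) (blast intro: openin_hausdorff_subset)
  qed
  show ?thesis
  proof (rule quasi_all_if_dense_subset [of "W ` (\<G> \<times> UNIV)" _ ?F])
    show "?F \<subseteq> mspace (hausdorff_metric circle)"
      using D(1) by (auto simp: compacts_def finite_imp_compact)
    have W: "?F \<subseteq> W (g, m)" if "g \<in> \<G>" for g m
      using that close D(1) by (auto simp: W_def compacts_def finite_imp_compact)
    show "?F \<subseteq> \<Inter>(W ` (\<G> \<times> UNIV))"
    proof (intro INT_greatest)
      fix p
      assume "p \<in> \<G> \<times> (UNIV :: nat set)"
      then obtain g m where "p = (g, m)" "g \<in> \<G>"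
        by blast
      then show "?F \<subseteq> W p"
        using W by simp
    qed
    show "mtopology_of (hausdorff_metric circle) closure_of ?F = mspace (hausdorff_metric circle)"
      using finite_subsets_dense_hausdorff [OF D] by simp
    show "uniformly_universal_on E (\<lambda>n. fourier_sum n f)"
      if "E \<in> mspace (hausdorff_metric circle)" "E \<in> \<Inter>(W ` (\<G> \<times> UNIV))" for E
      using that by (intro uniformly_universal_onI [of E \<G>] \<G>(3)) (auto simp: W_def compacts_def)
  qed (use openW \<G>(1) in auto)
qed

theorem theorem2:
  shows "quasi_all (C_metric circle)
           (\<lambda>f. quasi_all (hausdorff_metric circle)
                  (\<lambda>E. uniformly_universal_on E (\<lambda>n. fourier_sum n f)))"
proof -
  obtain \<G> :: "(complex \<Rightarrow> complex) set" where \<G>: "countable \<G>"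
    "\<And>g. g \<in> \<G> \<Longrightarrow> continuous_on circle g"
    "\<And>E \<phi> e. \<lbrakk>compact E; E \<subseteq> circle; continuous_on E \<phi>; e > 0\<rbrakk>
       \<Longrightarrow> \<exists>g\<in>\<G>. \<forall>z\<in>E. cmod (\<phi> z - g z) < e"
    using countable_laurent_approximation by metis
  obtain D :: "complex set" where D: "countable D" "D \<subseteq> circle" "circle \<subseteq> closure D"
    using separable [of circle] by metis
  let ?F = "{F. finite F \<and> F \<subseteq> D}"
  define V where "V = (\<lambda>(F, g, m). {f \<in> mspace (C_metric circle).
    \<exists>n. \<forall>z\<in>F. cmod (fourier_sum n f z - g z) < 1 / real (Suc m)})"
  show ?thesis
  proof (rule quasi_all_Baire [of _ "V ` (?F \<times> \<G> \<times> UNIV)"])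
    show "countable (V ` (?F \<times> \<G> \<times> (UNIV :: nat set)))"
      using \<G>(1) D(1) countable_Collect_finite_subset
      by (intro countable_image countable_SIGMA) auto
  next
    fix U
    assume "U \<in> V ` (?F \<times> \<G> \<times> UNIV)"
    then obtain F g m where U: "U = V (F, g, m)" "finite F" "F \<subseteq> circle"
      using D(2) by auto
    show "openin (mtopology_of (C_metric circle)) U"
      unfolding U(1) V_def prod.case by (intro openin_fourier_sum_close U)
    show "mtopology_of (C_metric circle) closure_of U = mspace (C_metric circle)"
      unfolding U(1) V_def prod.case by (intro dense_fourier_sum_close U) simp
  next
    fix f
    assume f: "f \<in> \<Inter>(V ` (?F \<times> \<G> \<times> UNIV))"
    show "quasi_all (hausdorff_metric circle) (\<lambda>E. uniformly_universal_on E (\<lambda>n. fourier_sum n f))"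
    proof (rule quasi_all_universal_if_close_on_finite [OF \<G> D(2,3)])
      fix F g m
      assume "finite F" "F \<subseteq> D" "g \<in> \<G>"
      with f have "f \<in> V (F, g, m)"
        by auto
      then show "\<exists>n. \<forall>z\<in>F. cmod (fourier_sum n f z - g z) < 1 / real (Suc m)"
        by (simp add: V_def)
    qed
  qed (rule mcomplete_of_C_metric)
qed

end
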